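(* For all integers $a \geq 0$ and $b \geq 0$, \[ \sum_{PF\in \mathcal{PF}_{a,b}} q^{\operatorname{coarea}(PF)+\operatorname{dinv}(PF)} = \frac{q^{\binom{a}{2}+\binom{b}{2}}}{[a+b+1]_q} \begin{bmatrix} a+b+1 \\ a \end{bmatrix}_q \begin{bmatrix} a+b+1 \\ b \end{bmatrix}_q . \]
   Context: A parking function of size $n$ is a two-line array $PF=\begin{bmatrix} v_1 & \cdots & v_n \\ u_1 & \cdots & u_n\end{bmatrix}$ where $u_1=0$, $0\le u_i\le u_{i-1}+1$ for $i\ge 2$, $(v_1,\dots,v_n)$ is a permutation of $\{1,\dots,n\}$, and $u_i=u_{i-1}+1$ implies $v_i>v_{i-1}$. Define $\operatorname{area}(PF)=\sum_i u_i$, $\operatorname{coarea}(PF)=\binom{n}{2}-\operatorname{area}(PF)$, and $\operatorname{dinv}(PF)=\#\{i<j: u_i=u_j,\ v_i<v_j\}+\#\{i<j: u_i=u_j+1,\ v_i>v_j\}$. The diagonal (reading) word $\sigma(PF)$ is obtained by listing the cars $v_i$ in order of decreasing value of $u_i$, and, among indices with the same value of $u_i$, in decreasing order of the index $i$. For $a+b=n$, $\mathcal{PF}_{a,b}$ is the set of parking functions of size $n$ whose word $\sigma(PF)$ is a shuffle of the words $1\,2\cdots a$ and $(a+1)(a+2)\cdots(a+b)$. $[m]_q=1+q+\dots+q^{m-1}$, and $\begin{bmatrix} m\\ k\end{bmatrix}_q=\frac{[m]_q!}{[k]_q![m-k]_q!}$ is the Gaussian binomial coefficient, with $[m]_q!=[1]_q\cdots[m]_q$.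 *)

theory Defs
  imports "HOL-Computational_Algebra.Polynomial" "HOL-Computational_Algebra.Fraction_Field"
begin

text \<open>
  A two-line array is a pair \<open>(v, u)\<close> of lists, cars \<open>v\<close> above and area sequence \<open>u\<close> below.
  Columns are numbered from 0, so \<open>v\<^sub>i\<close>, \<open>u\<^sub>i\<close> of the literature are \<open>v ! (i - 1)\<close>, \<open>u ! (i - 1)\<close>;
  the cars themselves are still \<open>1, \<dots>, n\<close>.
\<close>

type_synonym two_line = "nat list \<times> nat list"

definition parking_functions :: "nat \<Rightarrow> two_line set" where
  "parking_functions n = {(v, u).
     length v = n \<and> length u = n \<and>
     (0 < n \<longrightarrow> u ! 0 = 0) \<and>
     (\<forall>i. 0 < i \<and> i < n \<longrightarrow> u ! i \<le> u ! (i - 1) + 1) \<and>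
     distinct v \<and> set v = {1..n} \<and>
     (\<forall>i. 0 < i \<and> i < n \<longrightarrow> u ! i = u ! (i - 1) + 1 \<longrightarrow> v ! (i - 1) < v ! i)}"

definition area :: "two_line \<Rightarrow> nat" where
  "area = (\<lambda>(v, u). \<Sum>i<length u. u ! i)"

text \<open>
  The subtraction in \<open>coarea\<close> does not truncate on parking functions, see \<open>area_le\<close> below.
\<close>

definition coarea :: "two_line \<Rightarrow> nat" where
  "coarea = (\<lambda>(v, u). (length u choose 2) - area (v, u))"

definition dinv :: "two_line \<Rightarrow> nat" where
  "dinv = (\<lambda>(v, u).
     card {(i, j). i < j \<and> j < length u \<and> u ! i = u ! j \<and> v ! i < v ! j} +
     card {(i, j). i < j \<and> j < length u \<and> u ! i = u ! j + 1 \<and> v ! i > v ! j})"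

text \<open>
  The values \<open>k\<close> of \<open>u\<close> are scanned downwards from \<open>n - 1\<close>; every entry of \<open>u\<close> is met, because
  the entries in a parking function of size \<open>n\<close> are less than \<open>n\<close> (see \<open>nth_le_index\<close> below).
\<close>

definition diagonal_word :: "two_line \<Rightarrow> nat list" where
  "diagonal_word = (\<lambda>(v, u).
     [v ! i. k \<leftarrow> rev [0..<length u], i \<leftarrow> rev [0..<length u], u ! i = k])"

definition shuffle_parking_functions :: "nat \<Rightarrow> nat \<Rightarrow> two_line set" where
  "shuffle_parking_functions a b = {PF \<in> parking_functions (a + b).
     diagonal_word PF \<in> shuffles [1..<a + 1] [a + 1..<a + b + 1]}"

definition q_int :: "'a::field \<Rightarrow> nat \<Rightarrow> 'a" where
  "q_int q m = (\<Sum>i<m. q ^ i)"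

definition q_fact :: "'a::field \<Rightarrow> nat \<Rightarrow> 'a" where
  "q_fact q m = (\<Prod>i=1..m. q_int q i)"

text \<open>
  Meaningful for \<open>k \<le> m\<close> and \<open>q\<close> such that no \<open>q_int q i\<close> with \<open>1 \<le> i \<le> m\<close> vanishes, in
  particular for an indeterminate \<open>q\<close>.
\<close>

definition q_binomial :: "'a::field \<Rightarrow> nat \<Rightarrow> nat \<Rightarrow> 'a" where
  "q_binomial q m k = q_fact q m / (q_fact q k * q_fact q (m - k))"

text \<open>The indeterminate of the field \<open>\<rat>(q)\<close> of rational functions.\<close>

definition indet :: "rat poly fract" where
  "indet = Fract [:0, 1:] 1"

lemma nth_le_index:
  assumes "(v, u) \<in> parking_functions n" "i < n"
  shows "u ! i \<le> i"
  using assms(2)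
proof (induction i)
  case 0
  then show ?case using assms(1) by (auto simp: parking_functions_def)
next
  case (Suc i)
  have "0 < Suc i \<and> Suc i < n \<longrightarrow> u ! Suc i \<le> u ! (Suc i - 1) + 1"
    using assms(1) unfolding parking_functions_def by blast
  with Suc show ?case by simp
qed

lemma area_le:
  assumes "PF \<in> parking_functions n"
  shows "area PF \<le> n choose 2"
proof -
  obtain v u where PF: "PF = (v, u)" by fastforce
  have len: "length u = n"
    using assms by (auto simp: PF parking_functions_def)
  have "(\<Sum>i<n. u ! i) \<le> (\<Sum>i<n. i)"
    using assms by (intro sum_mono) (auto simp: PF intro: nth_le_index)
  also have "\<dots> = n choose 2"
    by (induction n) (auto simp: numeral_2_eq_2)
  finally show ?thesis by (simp add: area_def PF len)
qed

lemma finite_parking_functions: "finite (parking_functions n)"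
proof (rule finite_subset)
  let ?L = "{xs. set xs \<subseteq> {..n} \<and> length xs = n}"
  show "parking_functions n \<subseteq> ?L \<times> ?L"
  proof
    fix PF assume "PF \<in> parking_functions n"
    moreover obtain v u where PF: "PF = (v, u)" by fastforce
    ultimately have m: "(v, u) \<in> parking_functions n" by simp
    then have "length v = n" "length u = n" "set v = {1..n}"
      by (auto simp: parking_functions_def)
    moreover have "set u \<subseteq> {..n}"
      using nth_le_index[OF m] \<open>length u = n\<close> by (force simp: in_set_conv_nth)
    ultimately show "PF \<in> ?L \<times> ?L" by (auto simp: PF)
  qed
  show "finite (?L \<times> ?L)"
    by (intro finite_cartesian_product finite_lists_length_eq) auto
qed

lemma finite_shuffle_parking_functions: "finite (shuffle_parking_functions a b)"
  by (simp add: shuffle_parking_functions_def finite_parking_functions)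

end

theory Submission
  imports Defs
begin

text \<open>
  Call a car small if it is at most \<open>a\<close> and big otherwise. In a parking function whose diagonal word is
  a shuffle, the cars of each colour increase along the reading order, so the cars are determined by
  the area sequence and the colours. Both the parking condition and the dinv statistic can be read off
  the colours: a step \<open>u\<^sub>i = u\<^sub>i\<^sub>-\<^sub>1 + 1\<close> must go from a small to a big car.

  Let \<open>R(c; A, B)\<close> be the generating function, with \<open>t = 1/q\<close> marking area, of the \<open>A\<close> small and
  \<open>B\<close> big cars that stand above a level with \<open>c\<close> small cars. Splitting off the next level, with
  \<open>r\<close> small and \<open>s\<close> big cars, gives
  \<open>q\<^bsup>A + B\<^esup> R(c; A, B) = \<Sum> [c + s - 1 choose s]\<^sub>q [r + s - 1 choose r]\<^sub>q R(r; A - r, B - s)\<close>,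
  and two applications of the \<open>q\<close>-Vandermonde identity show by induction that
  \<open>R(c; A, B) = q\<^bsup>-(A + 1) B\<^esup> [c]\<^sub>q / [A + c]\<^sub>q [A + B + c - 1 choose B]\<^sub>q [A + B - 1 choose A]\<^sub>q\<close>.
  The sum in question is \<open>q\<^bsup>a + b + 1\<^esup> R(1; a, b + 1)\<close>, up to the factor
  \<open>q\<^bsup>(a + b choose 2)\<^esup>\<close>.
\<close>

section \<open>Gaussian binomial coefficients\<close>

text \<open>The assumptions permit division by powers of \<open>q\<close> and by q-factorials;
  \<open>generic_q_indet\<close> supplies them for the indeterminate.\<close>

locale generic_q =
  fixes q :: "'a::field"
  assumes q_nonzero: "q \<noteq> 0"
    and q_int_Suc_nonzero: "q_int q (Suc n) \<noteq> 0"
begin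

abbreviation qi :: "nat \<Rightarrow> 'a" where
  "qi n \<equiv> q_int q n"

lemma q_int_0 [simp]: "qi 0 = 0"
  by (simp add: q_int_def)

lemma q_int_add: "qi (m + n) = qi m + q ^ m * qi n"
  by (induction n) (simp_all add: q_int_def power_add algebra_simps)

lemma q_fact_0 [simp]: "q_fact q 0 = 1"
  by (simp add: q_fact_def)

lemma q_fact_Suc [simp]: "q_fact q (Suc n) = q_fact q n * qi (Suc n)"
  by (simp add: q_fact_def)

lemma q_fact_nonzero [simp]: "q_fact q n \<noteq> 0"
  by (induction n) (auto simp: q_int_Suc_nonzero)

text \<open>Indexing by the two complementary parts makes the coefficient symmetric and avoids
  truncated subtraction.\<close>

definition gauss :: "nat \<Rightarrow> nat \<Rightarrow> 'a" where
  "gauss m k = q_binomial q (m + k) k"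

lemma gauss_eq: "gauss m k = q_fact q (m + k) / (q_fact q m * q_fact q k)"
  by (simp add: gauss_def q_binomial_def mult.commute)

lemma gauss_0_left [simp]: "gauss 0 k = 1"
  and gauss_0_right [simp]: "gauss m 0 = 1"
  by (simp_all add: gauss_eq)

lemma gauss_commute: "gauss m k = gauss k m"
  by (simp add: gauss_eq add.commute mult.commute)

lemma gauss_Suc_left: "qi (Suc m) * gauss (Suc m) k = qi (Suc (m + k)) * gauss m k"
  using q_int_Suc_nonzero[of m] by (simp add: gauss_eq divide_simps)

lemma gauss_Suc_right: "qi (Suc k) * gauss m (Suc k) = qi (Suc (m + k)) * gauss m k"
  using gauss_Suc_left[of k m] by (simp add: gauss_commute add.commute)

lemma gauss_absorb: "qi (Suc k) * gauss m (Suc k) = qi (Suc m) * gauss (Suc m) k"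
  by (simp add: gauss_Suc_left gauss_Suc_right)

text \<open>The q-Pascal rule. After multiplication by \<open>qi (Suc k)\<close> it follows from
  \<open>q_int_add\<close> and one absorption.\<close>

lemma gauss_Suc_Suc:
  "gauss (Suc m) (Suc k) = gauss m (Suc k) + q ^ Suc m * gauss (Suc m) k"
proof -
  have "qi (Suc k) * gauss (Suc m) (Suc k) = qi (Suc m + Suc k) * gauss (Suc m) k"
    by (simp add: gauss_Suc_right)
  also have "\<dots> = qi (Suc k) * (gauss m (Suc k) + q ^ Suc m * gauss (Suc m) k)"
    unfolding q_int_add by (simp add: algebra_simps flip: gauss_absorb)
  finally show ?thesis
    using q_int_Suc_nonzero by simp
qed

lemma sum_gauss: "(\<Sum>i\<le>N. q ^ i * gauss i m) = gauss N (Suc m)"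
  by (induction N) (simp_all add: gauss_Suc_Suc)

text \<open>Cut a word with \<open>N\<close> letters of one kind and \<open>m + l + 1\<close> of the
  other at letter number \<open>m + 1\<close> of the second kind: each of the \<open>i\<close>
  letters of the first kind before the cut contributes \<open>q\<close> for the cut letter and for
  each of the \<open>l\<close> letters of the second kind behind it.\<close>

lemma q_Vandermonde:
  "(\<Sum>i\<le>N. gauss i m * gauss (N - i) l * q ^ (Suc l * i)) = gauss N (Suc (m + l))"
proof (induction l arbitrary: N)
  case 0
  then show ?case by (simp add: mult.commute flip: sum_gauss)
next
  case (Suc l)
  note IH = Suc.IH
  show ?case
  proof (induction N)
    case 0
    then show ?case by simp
  next
    case (Suc N)
    \<comment> \<open>The q-Pascal rule on the second factor leaves \<open>?f\<close>, handled by
      the inner induction on \<open>N\<close>, and \<open>?g\<close>, handled by the outer one on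
      \<open>l\<close>. The term at \<open>Suc N\<close>, where the rule does not apply, completes
      the sum of \<open>?g\<close>.\<close>
    let ?f = "\<lambda>i. gauss i m * gauss (N - i) (Suc l) * q ^ (Suc (Suc l) * i)"
    let ?g = "\<lambda>i. q ^ Suc N * (gauss i m * gauss (Suc N - i) l * q ^ (Suc l * i))"
    have "gauss i m * gauss (Suc N - i) (Suc l) * q ^ (Suc (Suc l) * i) = ?f i + ?g i"
      if "i \<le> N" for i
    proof -
      have "Suc N - i = Suc (N - i)" "q ^ N = q ^ i * q ^ (N - i)"
        using that by (simp_all flip: power_add)
      then show ?thesis
        by (simp add: gauss_Suc_Suc power_add algebra_simps)
    qed
    then have "(\<Sum>i\<le>N. gauss i m * gauss (Suc N - i) (Suc l) * q ^ (Suc (Suc l) * i)) =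
      (\<Sum>i\<le>N. ?f i) + (\<Sum>i\<le>N. ?g i)"
      unfolding sum.distrib[symmetric] by (intro sum.cong refl) (simp only: atMost_iff)
    moreover have "gauss (Suc N) m * gauss (Suc N - Suc N) (Suc l) * q ^ (Suc (Suc l) * Suc N) = ?g (Suc N)"
      unfolding mult_Suc[of "Suc l"] power_add
      by (simp only: diff_self_eq_0 gauss_0_left mult_1_right mult_ac)
    ultimately have "(\<Sum>i\<le>Suc N. gauss i m * gauss (Suc N - i) (Suc l) * q ^ (Suc (Suc l) * i)) =
      (\<Sum>i\<le>N. ?f i) + ((\<Sum>i\<le>N. ?g i) + ?g (Suc N))"
      by (simp only: sum.atMost_Suc add.assoc)
    also have "(\<Sum>i\<le>N. ?g i) + ?g (Suc N) = (\<Sum>i\<le>Suc N. ?g i)"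
      by (simp only: sum.atMost_Suc)
    also have "\<dots> = q ^ Suc N * gauss (Suc N) (Suc (m + l))"
      by (simp only: IH flip: sum_distrib_left)
    finally show ?case
      unfolding Suc.IH gauss_Suc_Suc[of N "m + Suc l"] by (simp only: add_Suc_right)
  qed
qed

text \<open>
  Weight of the ways to distribute \<open>k\<close> chunks over \<open>m\<close> slots; equals \<open>[m + k - 1 choose k]\<^sub>q\<close>,
  but the recursion also gives the right value at \<open>m = 0\<close>.
\<close>

primrec block :: "nat \<Rightarrow> nat \<Rightarrow> 'a" where
  "block 0 k = (if k = 0 then 1 else 0)"
| "block (Suc m) k = (\<Sum>i\<le>k. q ^ i * block m i)"

lemma block_Suc: "block (Suc m) k = gauss m k"
proof (induction m arbitrary: k)
  case 0
  have "(\<Sum>i\<le>k. q ^ i * (if i = 0 then 1 else 0)) = (\<Sum>i\<in>{0}. q ^ i)"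
    by (intro sum.mono_neutral_cong_right) auto
  then show ?case by simp
next
  case (Suc m)
  have "block (Suc (Suc m)) k = (\<Sum>i\<le>k. q ^ i * gauss i m)"
    by (simp only: block.simps(2)[of "Suc m"] Suc gauss_commute)
  then show ?case
    by (simp only: sum_gauss gauss_commute)
qed

lemma block_unfold: "block m k = (if m = 0 then if k = 0 then 1 else 0 else gauss (m - 1) k)"
  by (cases m) (simp_all only: block.simps(1) block_Suc, simp_all)

text \<open>In the closed form for \<open>R r (A - r) (B - s)\<close> the denominator is
  \<open>qi A\<close> for every \<open>r\<close>, so the sums over \<open>r\<close> and then over
  \<open>s\<close> are both q-Vandermonde sums. The successors exclude the initial values at third
  argument 0 and the zeros at first argument 0.\<close>

lemma recurrence_solution:
  fixes R :: "nat \<Rightarrow> nat \<Rightarrow> nat \<Rightarrow> 'a"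
  assumes R_0: "\<And>c A. R c A 0 = (if A = 0 then 1 else 0)"
    and R_Suc: "\<And>c A B. q ^ (A + Suc B) * R c A (Suc B) =
      (\<Sum>r\<le>A. \<Sum>s\<le>B. block c (Suc s) * gauss r s * R r (A - r) (B - s))"
  shows "q ^ (Suc A * Suc B) * qi (Suc (A + c)) * R (Suc c) A (Suc B) =
    qi (Suc c) * gauss (A + c) (Suc B) * gauss A B"
proof (induction "A + B" arbitrary: A B c rule: less_induct)
  case less
  have R_0_Suc: "R 0 A' (Suc B') = 0" for A' B'
    using R_Suc[of A' B' 0] q_nonzero by simp
  show ?case
  proof (cases A)
    case 0
    \<comment> \<open>With \<open>A = 0\<close> only \<open>r = 0\<close> occurs, and
      \<open>R 0 0 (B - s)\<close> vanishes unless \<open>s = B\<close>.\<close>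
    have "(\<Sum>s\<le>B. gauss c (Suc s) * R 0 0 (B - s)) = (\<Sum>s\<in>{B}. gauss c (Suc s))"
    proof (intro sum.mono_neutral_cong_right)
      show "\<forall>s\<in>{..B} - {B}. gauss c (Suc s) * R 0 0 (B - s) = 0"
      proof
        fix s assume "s \<in> {..B} - {B}"
        then have "B - s = Suc (B - s - 1)" by auto
        then show "gauss c (Suc s) * R 0 0 (B - s) = 0"
          using R_0_Suc[of 0 "B - s - 1"] by simp
      qed
    qed (auto simp: R_0)
    then have "q ^ Suc B * R (Suc c) 0 (Suc B) = gauss c (Suc B)"
      using R_Suc[of 0 B "Suc c"] by (simp add: block_Suc del: block.simps power_Suc)
    then show ?thesis
      by (simp add: 0 mult_ac del: power_Suc)
  next
    case (Suc a)
    \<comment> \<open>The sum over \<open>r\<close> for fixed \<open>s\<close>. At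
      \<open>s = B\<close> the initial values of \<open>R\<close> replace the induction hypothesis
      and leave only \<open>r = A\<close>.\<close>
    have inner: "q ^ (A * (B - s)) * qi A * (\<Sum>r\<le>A. gauss r s * R r (A - r) (B - s)) =
      qi (Suc s) * gauss a (B - s) * gauss a (Suc B)" if "s \<le> B" for s
    proof (cases "s = B")
      case True
      have "(\<Sum>r\<le>A. gauss r s * R r (A - r) (B - s)) = (\<Sum>r\<in>{A}. gauss r s)"
        by (intro sum.mono_neutral_cong_right) (auto simp: True R_0)
      then show ?thesis
        using gauss_absorb[of B a] by (simp add: True Suc)
    next
      case False
      with that have "s < B" by simp
      then obtain e where e: "B = Suc (s + e)"
        using less_imp_Suc_add by blast
      have eq: "q ^ (A * Suc e) * qi A * (gauss (Suc j) s * R (Suc j) (a - j) (Suc e)) =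
        qi (Suc s) * gauss a (Suc e) * (gauss j (Suc s) * gauss (a - j) e * q ^ (Suc e * j))"
        if "j \<le> a" for j
      proof -
        \<comment> \<open>Induction hypothesis for \<open>r = Suc j\<close>: the factor
          \<open>qi (Suc (a - j + j))\<close> is \<open>qi A\<close> whatever \<open>j\<close>
          is.\<close>
        have "q ^ (Suc (a - j) * Suc e) * qi (Suc (a - j + j)) * R (Suc j) (a - j) (Suc e) =
          qi (Suc j) * gauss (a - j + j) (Suc e) * gauss (a - j) e"
          by (intro less) (auto simp: Suc e)
        then have less': "q ^ (Suc (a - j) * Suc e) * qi A * R (Suc j) (a - j) (Suc e) =
          qi (Suc j) * gauss a (Suc e) * gauss (a - j) e"
          by (simp only: Suc le_add_diff_inverse2[OF that])
        have pow: "q ^ (A * Suc e) = q ^ (Suc e * j) * q ^ (Suc (a - j) * Suc e)"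
        proof -
          from \<open>j \<le> a\<close> obtain i where "a = j + i"
            using le_Suc_ex by blast
          then have "A * Suc e = Suc e * j + Suc (a - j) * Suc e"
            by (simp only: Suc diff_add_inverse) (simp add: algebra_simps)
          then show ?thesis
            by (simp only: power_add)
        qed
        have "q ^ (A * Suc e) * qi A * (gauss (Suc j) s * R (Suc j) (a - j) (Suc e)) =
          q ^ (Suc e * j) * gauss (Suc j) s *
            (qi (Suc j) * gauss a (Suc e) * gauss (a - j) e)"
          unfolding pow less'[symmetric] by (simp only: mult.assoc mult.commute mult.left_commute)
        also have "\<dots> = qi (Suc j) * gauss (Suc j) s * (q ^ (Suc e * j) * gauss a (Suc e) * gauss (a - j) e)"
          by (simp only: mult.assoc mult.commute mult.left_commute)
        finally show ?thesis
          unfolding gauss_absorb[symmetric] by (simp only: mult.assoc mult.commute mult.left_commute)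
      qed
      \<comment> \<open>The term \<open>r = 0\<close> drops out by \<open>R_0_Suc\<close>.\<close>
      have "(\<Sum>r\<le>A. gauss r s * R r (A - r) (B - s)) =
        (\<Sum>j\<le>a. gauss (Suc j) s * R (Suc j) (a - j) (Suc e))"
        unfolding Suc sum.atMost_Suc_shift by (simp add: e R_0_Suc)
      then have "q ^ (A * (B - s)) * qi A * (\<Sum>r\<le>A. gauss r s * R r (A - r) (B - s)) =
        (\<Sum>j\<le>a. q ^ (A * Suc e) * qi A * (gauss (Suc j) s * R (Suc j) (a - j) (Suc e)))"
        by (simp add: e sum_distrib_left)
      also have "\<dots> = qi (Suc s) * gauss a (Suc e) *
        (\<Sum>j\<le>a. gauss j (Suc s) * gauss (a - j) e * q ^ (Suc e * j))"
        unfolding sum_distrib_left by (intro sum.cong) (simp_all only: eq atMost_iff)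
      also have "\<dots> = qi (Suc s) * gauss a (Suc e) * gauss a (Suc B)"
        unfolding q_Vandermonde by (simp add: e)
      finally show ?thesis by (simp add: e)
    qed
    have "q ^ (A * B) * qi A * (q ^ (A + Suc B) * R (Suc c) A (Suc B)) =
      (\<Sum>s\<le>B. q ^ (A * B) * qi A * (gauss c (Suc s) * (\<Sum>r\<le>A. gauss r s * R r (A - r) (B - s))))"
      unfolding R_Suc block_Suc
      by (subst sum.swap) (simp add: sum_distrib_left mult_ac)
    \<comment> \<open>Absorption trades \<open>qi (Suc s)\<close> for the constant
      \<open>qi (Suc c)\<close>, so that the second q-Vandermonde sum appears.\<close>
    also have "\<dots> = (\<Sum>s\<le>B. qi (Suc c) * gauss a (Suc B) *
      (gauss s (Suc c) * gauss (B - s) a * q ^ (Suc a * s)))"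
    proof (intro sum.cong refl)
      fix s assume "s \<in> {..B}"
      then have "q ^ (A * B) = q ^ (Suc a * s) * q ^ (A * (B - s))"
        by (simp only: Suc[symmetric] power_add[symmetric] add_mult_distrib2[symmetric]) simp
      then have "q ^ (A * B) * qi A * (gauss c (Suc s) * (\<Sum>r\<le>A. gauss r s * R r (A - r) (B - s))) =
        q ^ (Suc a * s) * gauss c (Suc s) *
          (q ^ (A * (B - s)) * qi A * (\<Sum>r\<le>A. gauss r s * R r (A - r) (B - s)))"
        by (simp add: mult_ac)
      also have "\<dots> = qi (Suc s) * gauss c (Suc s) * (q ^ (Suc a * s) * gauss a (B - s) * gauss a (Suc B))"
        using \<open>s \<in> {..B}\<close> by (simp only: inner atMost_iff) (simp only: mult.assoc mult.commute mult.left_commute)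
      finally show "q ^ (A * B) * qi A * (gauss c (Suc s) * (\<Sum>r\<le>A. gauss r s * R r (A - r) (B - s))) =
        qi (Suc c) * gauss a (Suc B) * (gauss s (Suc c) * gauss (B - s) a * q ^ (Suc a * s))"
        unfolding gauss_absorb[of s c] gauss_commute[of "Suc c" s] gauss_commute[of a "B - s"]
        by (simp only: mult.assoc mult.commute mult.left_commute)
    qed
    also have "\<dots> = qi (Suc c) * gauss a (Suc B) * gauss (Suc (A + c)) B"
      unfolding sum_distrib_left[symmetric] q_Vandermonde
      by (simp add: Suc gauss_commute add.commute)
    finally have main: "q ^ (A * B) * qi A * (q ^ (A + Suc B) * R (Suc c) A (Suc B)) =
      qi (Suc c) * gauss a (Suc B) * gauss (Suc (A + c)) B" .
    have "q ^ (Suc A * Suc B) = q ^ (A * B) * q ^ (A + Suc B)"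
      by (simp add: add_ac flip: power_add)
    \<comment> \<open>The extra factors \<open>qi (Suc B)\<close> and \<open>qi A\<close> make room
      for two absorptions and cancel at the end.\<close>
    then have "qi (Suc B) * qi A * (q ^ (Suc A * Suc B) * qi (Suc (A + c)) * R (Suc c) A (Suc B)) =
      qi (Suc B) * qi (Suc (A + c)) * (q ^ (A * B) * qi A * (q ^ (A + Suc B) * R (Suc c) A (Suc B)))"
      by (simp only: mult.assoc mult.commute mult.left_commute)
    also have "\<dots> = (qi (Suc B) * gauss a (Suc B)) * (qi (Suc (A + c)) * gauss (Suc (A + c)) B) * qi (Suc c)"
      unfolding main by (simp only: mult.assoc mult.commute mult.left_commute)
    also have "\<dots> = qi (Suc B) * qi A * (qi (Suc c) * gauss (A + c) (Suc B) * gauss A B)"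
      unfolding gauss_absorb[of B "A + c", symmetric] gauss_absorb[of B a] Suc[symmetric]
      by (simp only: mult.assoc mult.commute mult.left_commute)
    finally show ?thesis
      using q_int_Suc_nonzero[of B] q_int_Suc_nonzero[of a] by (simp add: Suc)
  qed
qed

end

section \<open>Coloured area sequences and their levels\<close>

text \<open>
  Columns are stored from right to left as pairs of the level \<open>u\<^sub>i\<close> and the truth value of
  \<open>v\<^sub>i > a\<close>, so that a new column on the right is a \<open>Cons\<close>.
\<close>

type_synonym coloured = "(nat \<times> bool) list"

fun admissible :: "coloured \<Rightarrow> bool" where
  "admissible [] \<longleftrightarrow> True"
| "admissible [x] \<longleftrightarrow> fst x = 0"
| "admissible (x # y # xs) \<longleftrightarrow> fst x \<le> fst y + 1 \<and>
     (fst x = fst y + 1 \<longrightarrow> snd x \<and> \<not> snd y) \<and> admissible (y # xs)"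

text \<open>Pairs of one colour never contribute: in both kinds of dinv pair, the column required to
  hold the smaller car is the one read second.\<close>

primrec coloured_dinv :: "coloured \<Rightarrow> nat" where
  "coloured_dinv [] = 0"
| "coloured_dinv (x # xs) = coloured_dinv xs +
     (if snd x then count_list xs (fst x, False) else count_list xs (Suc (fst x), True))"

section \<open>Splitting off level 0\<close>

definition low :: "coloured \<Rightarrow> bool list" where
  "low xs = map snd (filter (\<lambda>x. fst x = 0) xs)"

definition high :: "coloured \<Rightarrow> coloured" where
  "high xs = map (\<lambda>x. (fst x - 1, snd x)) (filter (\<lambda>x. fst x > 0) xs)"

primrec word_inv :: "bool list \<Rightarrow> nat" where
  "word_inv [] = 0"
| "word_inv (x # w) = word_inv w + (if x then count_list w False else 0)"

primrec cross_inv :: "coloured \<Rightarrow> nat" where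
  "cross_inv [] = 0"
| "cross_inv (x # xs) = cross_inv xs + (if x = (0, False) then count_list xs (1, True) else 0)"

lemma low_simps [simp]:
  "low [] = []"
  "low (x # xs) = (if fst x = 0 then snd x # low xs else low xs)"
  by (simp_all add: low_def)

lemma high_simps [simp]:
  "high [] = []"
  "high (x # xs) = (if fst x = 0 then high xs else (fst x - 1, snd x) # high xs)"
  by (simp_all add: high_def)

lemma count_list_high: "count_list (high xs) (k, c) = count_list xs (Suc k, c)"
  by (induction xs) auto

lemma count_list_low: "count_list (low xs) c = count_list xs (0, c)"
  by (induction xs) auto

text \<open>A dinv pair lies within level 0, joins levels 1 and 0, or lies above level 0, where
  lowering all levels by one changes nothing.\<close>

lemma coloured_dinv_split: "coloured_dinv xs = word_inv (low xs) + cross_inv xs + coloured_dinv (high xs)"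
  by (induction xs) (auto simp: count_list_high count_list_low)

lemma count_colour_split:
  "count_list (map snd xs) c = count_list (low xs) c + count_list (map snd (high xs)) c"
  by (induction xs) auto

lemma length_split: "length xs = length (low xs) + length (high xs)"
  by (induction xs) auto

lemma sum_levels_split: "sum_list (map fst xs) = sum_list (map fst (high xs)) + length (high xs)"
  by (induction xs) auto

lemma length_count_bool: "length w = count_list w False + count_list w True"
  by (induction w) auto

lemma admissible_Cons:
  "admissible (x # xs) \<longleftrightarrow> (if xs = [] then fst x = 0 else
     fst x \<le> fst (hd xs) + 1 \<and> (fst x = fst (hd xs) + 1 \<longrightarrow> snd x \<and> \<not> snd (hd xs)) \<and> admissible xs)"
  by (cases xs) auto

lemma admissible_ConsD: "admissible (x # xs) \<Longrightarrow> admissible xs"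
  by (auto simp: admissible_Cons split: if_splits)

lemma admissible_Cons_0: "fst x = 0 \<Longrightarrow> admissible (x # xs) \<longleftrightarrow> admissible xs"
  by (auto simp: admissible_Cons)

text \<open>Levels start at 0 and rise by at most one per column; this bound yields
  finiteness.\<close>

lemma admissible_level_less: "admissible xs \<Longrightarrow> x \<in> set xs \<Longrightarrow> fst x < length xs"
proof (induction xs arbitrary: x)
  case (Cons y xs)
  have IH: "fst x < length xs" if "x \<in> set xs" for x
    using Cons that by (blast dest: admissible_ConsD)
  have "fst y \<le> length xs"
    using Cons.prems(1) IH[of "hd xs"] by (auto simp: admissible_Cons split: if_splits)
  then show ?case
    using Cons.prems(2) IH[of x] by auto
qed simp

lemma finite_admissible: "finite {xs. admissible xs \<and> length xs = n}"
proof (rule finite_subset)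
  let ?S = "{..<n} \<times> (UNIV :: bool set)"
  show "{xs. admissible xs \<and> length xs = n} \<subseteq> {xs. set xs \<subseteq> ?S \<and> length xs = n}"
    using admissible_level_less by force
qed (intro finite_lists_length_eq finite_cartesian_product finite_lessThan finite)

text \<open>The last entry is the leftmost column. Above level 0 the first column has risen from
  level 0, so it is big and on the lowest remaining level.\<close>

definition anchored :: "coloured \<Rightarrow> bool" where
  "anchored xs \<longleftrightarrow> admissible xs \<and> (xs \<noteq> [] \<longrightarrow> last xs = (0, True))"

lemma anchored_Nil [simp]: "anchored []"
  by (simp add: anchored_def)

lemma anchored_ConsD: "anchored (x # xs) \<Longrightarrow> anchored xs"
  by (auto simp: anchored_def dest: admissible_ConsD)

lemma anchored_Cons_0_True: "anchored ((0, True) # xs) \<longleftrightarrow> anchored xs"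
  by (auto simp: anchored_def admissible_Cons_0)

lemma anchored_count_pos: "anchored xs \<Longrightarrow> xs \<noteq> [] \<Longrightarrow> count_list xs (0, True) > 0"
  unfolding anchored_def by (metis count_list_0_iff last_in_set neq0_conv)

lemma last_low:
  "admissible xs \<Longrightarrow> xs \<noteq> [] \<Longrightarrow> low xs \<noteq> [] \<and> last xs = (0, last (low xs))"
proof (induction xs)
  case (Cons x xs)
  then show ?case
    by (cases xs) (auto simp: prod_eq_iff dest: admissible_ConsD)
qed simp

lemma hd_high:
  "fst (hd xs) > 0 \<Longrightarrow> xs \<noteq> [] \<Longrightarrow> high xs \<noteq> [] \<and> hd (high xs) = (fst (hd xs) - 1, snd (hd xs))"
  by (cases xs) auto

text \<open>Deleting level 0 changes a column's left neighbour only if that neighbour was on level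
  0; the column is then \<open>(1, True)\<close> and becomes \<open>(0, True)\<close>, which may
  follow anything and may come first.\<close>

lemma anchored_high: "admissible xs \<Longrightarrow> anchored (high xs)"
proof (induction xs)
  case (Cons x xs)
  then have IH: "anchored (high xs)"
    by (blast dest: admissible_ConsD)
  show ?case
  proof (cases "fst x = 0")
    case False
    with Cons.prems have ne: "xs \<noteq> []" by auto
    show ?thesis
    proof (cases "fst (hd xs) = 0")
      case True
      with Cons.prems ne False have "x = (1, True)"
        by (auto simp: admissible_Cons prod_eq_iff)
      then show ?thesis using IH by (simp add: anchored_Cons_0_True)
    next
      case hd: False
      note * = hd_high[of xs, OF _ ne]
      have "fst x - 1 \<le> fst (hd (high xs)) + 1 \<and>
        (fst x - 1 = fst (hd (high xs)) + 1 \<longrightarrow> snd x \<and> \<not> snd (hd (high xs)))"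
        using * hd False Cons.prems ne by (auto simp: admissible_Cons)
      then show ?thesis
        using IH * hd False by (simp add: anchored_def admissible_Cons)
    qed
  qed (use IH in simp)
qed simp

text \<open>
  Each column of \<open>ys\<close> other than the big cars of level 0 must directly follow its left neighbour in \<open>ys\<close>,
  so merging \<open>w\<close> with \<open>ys\<close> means distributing chunks that each start with such a big car over the
  small cars of \<open>w\<close>.
\<close>

definition merges :: "bool list \<Rightarrow> coloured \<Rightarrow> coloured set" where
  "merges w ys = {xs. admissible xs \<and> low xs = w \<and> high xs = ys}"

definition merges_high :: "bool list \<Rightarrow> coloured \<Rightarrow> coloured set" where
  "merges_high w ys = {xs \<in> merges w ys. xs \<noteq> [] \<and> fst (hd xs) > 0}"

lemma finite_merges: "finite (merges w ys)"
proof (rule finite_subset[OF _ finite_admissible])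
  show "merges w ys \<subseteq> {xs. admissible xs \<and> length xs = length w + length ys}"
  proof
    fix xs assume "xs \<in> merges w ys"
    then show "xs \<in> {xs. admissible xs \<and> length xs = length w + length ys}"
      using length_split[of xs] by (simp add: merges_def)
  qed
qed

lemma finite_merges_high: "finite (merges_high w ys)"
  by (simp add: merges_high_def finite_merges)

lemma merges_Nil: "merges [] ys = (if ys = [] then {[]} else {})"
proof (rule set_eqI)
  fix xs
  show "xs \<in> merges [] ys \<longleftrightarrow> xs \<in> (if ys = [] then {[]} else {})"
    using last_low[of xs] by (cases "xs = []") (auto simp: merges_def)
qed

lemma merges_high_Nil: "merges_high w [] = {}"
proof -
  have "high xs \<noteq> []" if "xs \<noteq> []" "fst (hd xs) > 0" for xs
    using hd_high[of xs] that by simp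
  then show ?thesis
    by (auto simp: merges_high_def merges_def)
qed

lemma merges_Cons: "merges (c # w) ys = Cons (0, c) ` merges w ys \<union> merges_high (c # w) ys"
proof (intro equalityI subsetI)
  fix xs assume xs: "xs \<in> merges (c # w) ys"
  then obtain x xs' where [simp]: "xs = x # xs'"
    by (cases xs) (auto simp: merges_def)
  show "xs \<in> Cons (0, c) ` merges w ys \<union> merges_high (c # w) ys"
  proof (cases "fst x = 0")
    case True
    then have "x = (0, c)" "xs' \<in> merges w ys"
      using xs by (auto simp: merges_def admissible_Cons_0 prod_eq_iff)
    then show ?thesis by simp
  next
    case False
    then show ?thesis using xs by (simp add: merges_high_def)
  qed
qed (auto simp: merges_def merges_high_def admissible_Cons_0)

lemma merges_high_Cons:
  "merges_high w (y # ys) = Cons (Suc (fst y), snd y) `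
    {xs \<in> merges w ys. admissible ((Suc (fst y), snd y) # xs)}"
proof (intro equalityI subsetI)
  fix xs assume xs: "xs \<in> merges_high w (y # ys)"
  then obtain x xs' where [simp]: "xs = x # xs'"
    by (cases xs) (auto simp: merges_high_def)
  have "x = (Suc (fst y), snd y)" "xs' \<in> merges w ys"
    using xs by (auto simp: merges_def merges_high_def prod_eq_iff dest: admissible_ConsD)
  then show "xs \<in> Cons (Suc (fst y), snd y) `
      {xs \<in> merges w ys. admissible ((Suc (fst y), snd y) # xs)}"
    using xs by (auto simp: merges_def merges_high_def)
qed (auto simp: merges_def merges_high_def)

text \<open>Directly right of a level-0 column only \<open>(1, True)\<close> can rise. Any other
  raised column follows a high one, and admissibility of \<open>y # ys\<close> covers that
  step.\<close>

lemma merges_high_Cons_glued: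
  assumes "anchored (y # ys)" "y \<noteq> (0, True)"
  shows "merges_high w (y # ys) = Cons (Suc (fst y), snd y) ` merges_high w ys"
proof -
  \<comment> \<open>A single column would have to be the anchor \<open>(0, True)\<close>.\<close>
  have ys: "ys \<noteq> []" and adm: "admissible (y # ys)"
    using assms by (auto simp: anchored_def)
  have "admissible ((Suc (fst y), snd y) # xs) \<longleftrightarrow> xs \<noteq> [] \<and> fst (hd xs) > 0"
    if "xs \<in> merges w ys" for xs
  proof -
    have xs: "admissible xs" "high xs = ys" "xs \<noteq> []"
      using that ys by (auto simp: merges_def)
    show ?thesis
    proof (cases "fst (hd xs) = 0")
      case True
      then show ?thesis
        using xs assms(2) by (auto simp: admissible_Cons prod_eq_iff)
    next
      case False
      then show ?thesis
        using adm hd_high[of xs] xs ys by (auto simp: admissible_Cons)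
    qed
  qed
  then show ?thesis
    unfolding merges_high_Cons by (auto simp: merges_high_def)
qed

text \<open>The start \<open>(1, True)\<close> of a chunk may follow any high column, but on level 0
  only a small car.\<close>

lemma merges_high_Cons_free:
  "merges_high (c # w) ((0, True) # ys) = Cons (1, True) `
    (merges_high (c # w) ys \<union> (if c then {} else Cons (0, False) ` merges w ys))"
proof -
  have "{xs \<in> merges (c # w) ys. admissible ((1, True) # xs)} =
    merges_high (c # w) ys \<union> (if c then {} else Cons (0, False) ` merges w ys)"
    unfolding merges_Cons by (auto simp: merges_high_def merges_def admissible_Cons)
  then show ?thesis
    unfolding merges_high_Cons by simp
qed

section \<open>Weighted count of merges\<close>

context generic_q
begin

text \<open>Columns to the right of the last level-0 car would begin with a chunk directly on it,
  which a big car does not allow.\<close>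

lemma merges_high_True:
  "anchored ys \<Longrightarrow> merges_high (True # w) ys = {}"
proof (induction ys)
  case (Cons y ys)
  then have "anchored ys" by (blast dest: anchored_ConsD)
  with Cons show ?case
    by (cases "y = (0, True)") (simp_all add: merges_high_Cons_free merges_high_Cons_glued)
qed (simp add: merges_high_Nil)

text \<open>All chunks lie left of the added car; a small one forms a cross pair with the start of
  each of them.\<close>

lemma sum_merges_Cons_low:
  "(\<Sum>xs\<in>Cons (0, c) ` merges w ys. q ^ cross_inv xs) =
    (if c then 1 else q ^ count_list ys (0, True)) * (\<Sum>xs\<in>merges w ys. q ^ cross_inv xs)"
proof -
  have "count_list xs (1, True) = count_list ys (0, True)" if "xs \<in> merges w ys" for xs
    using that count_list_high[of xs 0 True] by (auto simp: merges_def)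
  then show ?thesis
    by (simp add: sum.reindex sum_distrib_left power_add mult.commute)
qed

lemma sum_cross_inv_Cons_Suc:
  "(\<Sum>xs\<in>Cons (Suc k, c) ` S. q ^ cross_inv xs) = (\<Sum>xs\<in>S. q ^ cross_inv xs)"
  by (simp add: sum.reindex)

text \<open>Here \<open>i\<close> counts the chunks left of the rightmost level-0 car, each paired
  with it; at least one chunk stands to its right, so \<open>i\<close> is below the total.\<close>

lemma sum_merges_high_False:
  assumes "\<And>ys. anchored ys \<Longrightarrow>
    (\<Sum>xs\<in>merges w ys. q ^ cross_inv xs) = block m (count_list ys (0, True))"
  shows "anchored ys \<Longrightarrow> (\<Sum>xs\<in>merges_high (False # w) ys. q ^ cross_inv xs) =
    (\<Sum>i<count_list ys (0, True). q ^ i * block m i)"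
proof (induction ys)
  case (Cons y ys)
  then have anch: "anchored ys" by (blast dest: anchored_ConsD)
  show ?case
  proof (cases "y = (0, True)")
    case True
    let ?k = "count_list ys (0, True)"
    have "(\<Sum>xs\<in>merges_high (False # w) (y # ys). q ^ cross_inv xs) =
      (\<Sum>xs\<in>merges_high (False # w) ys. q ^ cross_inv xs) +
      (\<Sum>xs\<in>Cons (0, False) ` merges w ys. q ^ cross_inv xs)"
      unfolding True merges_high_Cons_free One_nat_def sum_cross_inv_Cons_Suc
      by (subst sum.union_disjoint[symmetric])
         (auto simp: finite_merges finite_merges_high merges_high_def)
    also have "\<dots> = (\<Sum>i<?k. q ^ i * block m i) + q ^ ?k * block m ?k"
      by (simp only: Cons.IH anch sum_merges_Cons_low assms if_False)
    finally show ?thesis by (simp add: True)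
  next
    case False
    then show ?thesis
      using Cons anch by (simp add: merges_high_Cons_glued sum_cross_inv_Cons_Suc)
  qed
qed (simp add: merges_high_Nil)

text \<open>Big cars of level 0 carry no chunks and no weight. Each small car adds a slot: an empty
  slot gives the top term of the \<open>block\<close> recursion, a used one the rest.\<close>

lemma sum_merges:
  "anchored ys \<Longrightarrow> (\<Sum>xs\<in>merges w ys. q ^ cross_inv xs) =
    block (count_list w False) (count_list ys (0, True))"
proof (induction w arbitrary: ys)
  case Nil
  \<comment> \<open>A nonempty anchored \<open>ys\<close> contains a chunk, so
    \<open>block 0\<close> is 0, matching the empty set of merges.\<close>
  then show ?case
    by (auto simp: merges_Nil dest: anchored_count_pos)
next
  case (Cons c w)
  have "(\<Sum>xs\<in>merges (c # w) ys. q ^ cross_inv xs) =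
    (\<Sum>xs\<in>Cons (0, c) ` merges w ys. q ^ cross_inv xs) +
    (\<Sum>xs\<in>merges_high (c # w) ys. q ^ cross_inv xs)"
    unfolding merges_Cons
    by (subst sum.union_disjoint[symmetric])
       (auto simp: finite_merges finite_merges_high merges_high_def)
  moreover have "block (Suc m) k = q ^ k * block m k + (\<Sum>i<k. q ^ i * block m i)" for m k
    by (simp only: block.simps lessThan_Suc_atMost[symmetric] sum.lessThan_Suc add.commute)
  ultimately show ?case
    using Cons sum_merges_high_False[of w "count_list w False" ys]
    by (cases c) (simp_all add: sum_merges_Cons_low merges_high_True del: block.simps)
qed

end

section \<open>The generating function by levels\<close>

definition words :: "nat \<Rightarrow> nat \<Rightarrow> bool list set" where
  "words r s = {w. count_list w False = r \<and> count_list w True = s}"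

text \<open>The words that level 0 of an anchored sequence can carry: they run from right to left,
  so the last letter is the anchor.\<close>

definition rooted_words :: "nat \<Rightarrow> nat \<Rightarrow> bool list set" where
  "rooted_words r s = {w \<in> words r s. w \<noteq> [] \<longrightarrow> last w}"

lemma finite_words: "finite (words r s)"
proof (rule finite_subset)
  show "words r s \<subseteq> {w. set w \<subseteq> UNIV \<and> length w = r + s}"
    using length_count_bool by (auto simp: words_def)
qed (intro finite_lists_length_eq finite)

lemma words_0_0: "words 0 0 = {[]}"
proof (rule set_eqI)
  fix w
  show "w \<in> words 0 0 \<longleftrightarrow> w \<in> {[]}"
    using length_count_bool[of w] by (cases w) (auto simp: words_def)
qed

lemma words_Suc_0: "words (Suc r) 0 = Cons False ` words r 0"
  and words_0_Suc: "words 0 (Suc s) = Cons True ` words 0 s"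
  and words_Suc_Suc: "words (Suc r) (Suc s) = Cons False ` words r (Suc s) \<union> Cons True ` words (Suc r) s"
proof -
  have *: "w \<in> words r s \<longleftrightarrow> (case w of [] \<Rightarrow> r = 0 \<and> s = 0
      | c # w' \<Rightarrow> if c then s > 0 \<and> w' \<in> words r (s - 1) else r > 0 \<and> w' \<in> words (r - 1) s)" for w r s
    by (auto simp: words_def split: list.splits)
  show "words (Suc r) 0 = Cons False ` words r 0"
    by (rule set_eqI, subst *) (auto split: list.splits if_splits)
  show "words 0 (Suc s) = Cons True ` words 0 s"
    by (rule set_eqI, subst *) (auto split: list.splits if_splits)
  show "words (Suc r) (Suc s) = Cons False ` words r (Suc s) \<union> Cons True ` words (Suc r) s"
    by (rule set_eqI, subst *) (auto split: list.splits if_splits)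
qed

lemma rooted_words_0: "rooted_words r 0 = (if r = 0 then {[]} else {})"
proof -
  have "w = []" if "w \<in> rooted_words r 0" for w
    using that last_in_set[of w] by (auto simp: rooted_words_def words_def count_list_0_iff)
  moreover have "[] \<in> rooted_words r 0 \<longleftrightarrow> r = 0"
    by (auto simp: rooted_words_def words_def)
  ultimately show ?thesis by auto
qed

lemma rooted_words_Suc: "rooted_words r (Suc s) = (\<lambda>w. w @ [True]) ` words r s"
proof (intro equalityI subsetI)
  fix w assume w: "w \<in> rooted_words r (Suc s)"
  then have "w \<noteq> []" by (auto simp: rooted_words_def words_def)
  with w obtain v where "w = v @ [True]"
    by (cases w rule: rev_cases) (auto simp: rooted_words_def)
  with w show "w \<in> (\<lambda>w. w @ [True]) ` words r s"
    by (auto simp: rooted_words_def words_def)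
qed (auto simp: rooted_words_def words_def)

lemma word_inv_snoc_True: "word_inv (w @ [True]) = word_inv w"
  by (induction w) auto

section \<open>Sequences with prescribed colour counts\<close>

definition coloured_lists :: "nat \<Rightarrow> nat \<Rightarrow> coloured set" where
  "coloured_lists A B = {xs. admissible xs \<and>
     count_list (map snd xs) False = A \<and> count_list (map snd xs) True = B}"

definition anchored_lists :: "nat \<Rightarrow> nat \<Rightarrow> coloured set" where
  "anchored_lists A B = {xs \<in> coloured_lists A B. anchored xs}"

lemma length_coloured_lists: "xs \<in> coloured_lists A B \<Longrightarrow> length xs = A + B"
  using length_count_bool[of "map snd xs"] by (simp add: coloured_lists_def)

lemma finite_coloured_lists: "finite (coloured_lists A B)"
proof (rule finite_subset[OF _ finite_admissible])
  show "coloured_lists A B \<subseteq> {xs. admissible xs \<and> length xs = A + B}"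
    using length_coloured_lists by (auto simp: coloured_lists_def)
qed

lemma finite_anchored_lists: "finite (anchored_lists A B)"
  by (simp add: anchored_lists_def finite_coloured_lists)

lemma anchored_lists_0: "anchored_lists A 0 = (if A = 0 then {[]} else {})"
proof -
  have "xs = []" if "xs \<in> anchored_lists A 0" for xs
    using that last_in_set[of xs]
    by (force simp: anchored_lists_def coloured_lists_def anchored_def count_list_0_iff)
  moreover have "[] \<in> anchored_lists A 0 \<longleftrightarrow> A = 0"
    by (auto simp: anchored_lists_def coloured_lists_def)
  ultimately show ?thesis by auto
qed

lemma anchored_iff_low:
  assumes "admissible xs"
  shows "anchored xs \<longleftrightarrow> (low xs \<noteq> [] \<longrightarrow> last (low xs))"
  using assms last_low[OF assms] by (cases "xs = []") (auto simp: anchored_def)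

text \<open>Being anchored restricts only the word of level 0, and the part above is anchored
  automatically, so word and upper part are chosen independently.\<close>

lemma anchored_lists_level_iff:
  assumes "r \<le> A" "s \<le> B"
  shows "xs \<in> anchored_lists A B \<and> count_list (low xs) False = r \<and> count_list (low xs) True = s \<longleftrightarrow>
    (\<exists>w\<in>rooted_words r s. \<exists>ys\<in>anchored_lists (A - r) (B - s). xs \<in> merges w ys)"
  using assms anchored_high[of xs] anchored_iff_low[of xs]
  by (auto simp: anchored_lists_def coloured_lists_def rooted_words_def words_def merges_def
      count_colour_split[of xs] anchored_def)

lemma admissible_snoc_0_True: "admissible (xs @ [(0, True)]) \<longleftrightarrow> admissible xs"
  by (induction xs rule: admissible.induct) auto

lemma coloured_dinv_snoc_0_True: "coloured_dinv (xs @ [(0, True)]) = coloured_dinv xs"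
  by (induction xs) auto

lemma anchored_lists_Suc: "anchored_lists A (Suc B) = (\<lambda>xs. xs @ [(0, True)]) ` coloured_lists A B"
proof (intro equalityI subsetI)
  fix xs assume xs: "xs \<in> anchored_lists A (Suc B)"
  then have "xs \<noteq> []" by (auto simp: anchored_lists_def coloured_lists_def)
  with xs obtain ys where "xs = ys @ [(0, True)]"
    by (cases xs rule: rev_cases) (auto simp: anchored_lists_def anchored_def)
  with xs show "xs \<in> (\<lambda>xs. xs @ [(0, True)]) ` coloured_lists A B"
    by (auto simp: anchored_lists_def coloured_lists_def admissible_snoc_0_True)
qed (auto simp: anchored_lists_def coloured_lists_def admissible_snoc_0_True anchored_def)

context generic_q
begin

lemma sum_word_inv_Cons:
  "(\<Sum>w\<in>Cons c ` words r s. q ^ word_inv w) =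
    (if c then q ^ r else 1) * (\<Sum>w\<in>words r s. q ^ word_inv w)"
  by (simp add: sum.reindex sum_distrib_left)
     (auto intro!: sum.cong simp: words_def power_add)

text \<open>Removing the first letter gives the q-Pascal rule, since a leading big letter is paired
  with every small one.\<close>

lemma sum_word_inv: "(\<Sum>w\<in>words r s. q ^ word_inv w) = gauss r s"
proof (induction r arbitrary: s)
  case 0
  show ?case
    by (induction s) (simp_all add: words_0_0 words_0_Suc sum_word_inv_Cons)
next
  case (Suc r)
  note IH = Suc.IH
  show ?case
  proof (induction s)
    case 0
    then show ?case
      by (simp add: words_Suc_0 sum_word_inv_Cons IH)
  next
    case (Suc s)
    have "(\<Sum>w\<in>words (Suc r) (Suc s). q ^ word_inv w) =
      (\<Sum>w\<in>Cons False ` words r (Suc s). q ^ word_inv w) +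
      (\<Sum>w\<in>Cons True ` words (Suc r) s. q ^ word_inv w)"
      unfolding words_Suc_Suc
      by (rule sum.union_disjoint) (auto simp: finite_words)
    then show ?case
      by (simp only: sum_word_inv_Cons Suc.IH IH gauss_Suc_Suc if_True if_False mult_1)
  qed
qed

lemma sum_rooted_word_inv:
  "(\<Sum>w\<in>rooted_words r (Suc s). q ^ word_inv w) = gauss r s"
  by (simp add: rooted_words_Suc sum.reindex inj_on_def word_inv_snoc_True sum_word_inv)

text \<open>
  Generating function of everything that can stand above a level with \<open>c\<close> small cars, at \<open>t = 1/q\<close>.
\<close>

definition stacked :: "nat \<Rightarrow> nat \<Rightarrow> nat \<Rightarrow> 'a" where
  "stacked c A B = (\<Sum>ys\<in>anchored_lists A B. block c (count_list ys (0, True)) *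
     q ^ coloured_dinv ys * inverse q ^ (sum_list (map fst ys) + length ys))"

lemma stacked_eq:
  "q ^ (A + B) * stacked c A B = (\<Sum>ys\<in>anchored_lists A B. block c (count_list ys (0, True)) *
     q ^ coloured_dinv ys * inverse q ^ sum_list (map fst ys))"
  unfolding stacked_def sum_distrib_left
proof (intro sum.cong refl)
  fix ys assume "ys \<in> anchored_lists A B"
  then have "length ys = A + B"
    by (auto simp: anchored_lists_def length_coloured_lists)
  moreover have "q ^ (A + B) * inverse q ^ (A + B) = 1"
    using q_nonzero by (simp flip: power_mult_distrib)
  ultimately show "q ^ (A + B) * (block c (count_list ys (0, True)) * q ^ coloured_dinv ys *
      inverse q ^ (sum_list (map fst ys) + length ys)) =
    block c (count_list ys (0, True)) * q ^ coloured_dinv ys * inverse q ^ sum_list (map fst ys)"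
    by (simp only: power_add[of _ "sum_list (map fst ys)"] mult.left_commute[of "q ^ (A + B)"] mult_1_right)
qed

text \<open>Sequences are grouped by the colour counts of level 0, then by its word and the part
  above. Summing over the merges of such a pair produces the factor \<open>block r\<close> that
  \<open>stacked r\<close> contains.\<close>

lemma stacked_recurrence:
  "q ^ (A + B) * stacked c A B = (\<Sum>r\<le>A. \<Sum>s\<le>B. block c s *
     (\<Sum>w\<in>rooted_words r s. q ^ word_inv w) * stacked r (A - r) (B - s))"
proof -
  define h where "h ys = block c (count_list ys (0, True)) *
     q ^ coloured_dinv ys * inverse q ^ sum_list (map fst ys)" for ys :: coloured
  define g where "g ys = (count_list (low ys) False, count_list (low ys) True)" for ys :: coloured
  have inner: "sum h {ys \<in> anchored_lists A B. g ys = (r, s)} =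
    block c s * (\<Sum>w\<in>rooted_words r s. q ^ word_inv w) * stacked r (A - r) (B - s)"
    if rs: "r \<le> A" "s \<le> B" for r s
  proof -
    let ?W = "rooted_words r s" and ?Z = "anchored_lists (A - r) (B - s)"
    have "sum h {ys \<in> anchored_lists A B. g ys = (r, s)} =
      (\<Sum>p\<in>?W \<times> ?Z. sum h {ys \<in> {ys \<in> anchored_lists A B. g ys = (r, s)}. (low ys, high ys) = p})"
    proof (intro sum.group[symmetric])
      show "(\<lambda>ys. (low ys, high ys)) ` {ys \<in> anchored_lists A B. g ys = (r, s)} \<subseteq> ?W \<times> ?Z"
        using anchored_lists_level_iff[OF rs] by (fastforce simp: g_def merges_def)
      show "finite (?W \<times> ?Z)"
        by (intro finite_cartesian_product finite_anchored_lists)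
           (simp add: rooted_words_def finite_words)
    qed (simp add: finite_anchored_lists)
    also have "\<dots> = (\<Sum>(w, zs)\<in>?W \<times> ?Z. sum h (merges w zs))"
    proof (intro sum.cong refl, clarify)
      fix w zs assume wz: "w \<in> ?W" "zs \<in> ?Z"
      have "{ys \<in> {ys \<in> anchored_lists A B. g ys = (r, s)}. (low ys, high ys) = (w, zs)} = merges w zs"
        using anchored_lists_level_iff[OF rs] wz by (fastforce simp: g_def merges_def)
      then show "sum h {ys \<in> {ys \<in> anchored_lists A B. g ys = (r, s)}. (low ys, high ys) = (w, zs)} =
        sum h (merges w zs)" by simp
    qed
    also have "\<dots> = (\<Sum>(w, zs)\<in>?W \<times> ?Z. block c s * (q ^ word_inv w *
      (block r (count_list zs (0, True)) * q ^ coloured_dinv zs *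
        inverse q ^ (sum_list (map fst zs) + length zs))))"
    proof (intro sum.cong refl, clarify)
      fix w zs assume wz: "w \<in> ?W" "zs \<in> ?Z"
      \<comment> \<open>On a fixed set of merges only \<open>cross_inv\<close> varies; raising
        \<open>zs\<close> by one level accounts for \<open>length zs\<close> in the
        exponent.\<close>
      have "sum h (merges w zs) = (\<Sum>xs\<in>merges w zs. block c s * q ^ word_inv w *
        q ^ coloured_dinv zs * inverse q ^ (sum_list (map fst zs) + length zs) * q ^ cross_inv xs)"
      proof (intro sum.cong refl)
        fix xs assume "xs \<in> merges w zs"
        then have "low xs = w" "high xs = zs" "count_list xs (0, True) = s"
          using wz(1) count_list_low[of xs True] by (auto simp: merges_def rooted_words_def words_def)
        then show "h xs = block c s * q ^ word_inv w *
          q ^ coloured_dinv zs * inverse q ^ (sum_list (map fst zs) + length zs) * q ^ cross_inv xs"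
          by (simp add: h_def coloured_dinv_split[of xs] sum_levels_split[of xs] power_add mult_ac)
      qed
      also have "\<dots> = block c s * q ^ word_inv w *
        q ^ coloured_dinv zs * inverse q ^ (sum_list (map fst zs) + length zs) *
        block r (count_list zs (0, True))"
        using wz by (simp add: sum_distrib_left[symmetric] sum_merges anchored_lists_def
            rooted_words_def words_def)
      finally show "sum h (merges w zs) = block c s * (q ^ word_inv w *
        (block r (count_list zs (0, True)) * q ^ coloured_dinv zs *
          inverse q ^ (sum_list (map fst zs) + length zs)))"
        by (simp only: mult.assoc mult.commute mult.left_commute)
    qed
    also have "\<dots> = block c s * (\<Sum>w\<in>?W. q ^ word_inv w) * stacked r (A - r) (B - s)"
      unfolding stacked_def mult.assoc sum_product sum.cartesian_product
      by (simp add: sum_distrib_left case_prod_unfold)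
    finally show ?thesis .
  qed
  have "q ^ (A + B) * stacked c A B = sum h (anchored_lists A B)"
    by (simp add: stacked_eq h_def)
  also have "\<dots> = (\<Sum>p\<in>{..A} \<times> {..B}. sum h {ys \<in> anchored_lists A B. g ys = p})"
  proof (intro sum.group[symmetric])
    show "g ` anchored_lists A B \<subseteq> {..A} \<times> {..B}"
    proof (rule image_subsetI)
      fix ys assume "ys \<in> anchored_lists A B"
      then show "g ys \<in> {..A} \<times> {..B}"
        using count_colour_split[of ys False] count_colour_split[of ys True]
        by (simp add: g_def anchored_lists_def coloured_lists_def)
    qed
  qed (simp_all add: finite_anchored_lists)
  also have "\<dots> = (\<Sum>(r, s)\<in>{..A} \<times> {..B}. block c s *
     (\<Sum>w\<in>rooted_words r s. q ^ word_inv w) * stacked r (A - r) (B - s))"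
    by (intro sum.cong) (auto simp: inner)
  finally show ?thesis
    by (simp add: sum.cartesian_product)
qed

lemma stacked_0: "stacked c A 0 = (if A = 0 then block c 0 else 0)"
  by (simp add: stacked_def anchored_lists_0)

lemma block_0_right [simp]: "block c 0 = 1"
  by (simp add: block_unfold)

lemma stacked_0_Suc: "stacked 0 A (Suc B) = 0"
  unfolding stacked_def
  by (intro sum.neutral) (auto simp: anchored_lists_Suc)

lemma stacked_recurrence_Suc:
  "q ^ (A + Suc B) * stacked c A (Suc B) =
    (\<Sum>r\<le>A. \<Sum>s\<le>B. block c (Suc s) * gauss r s * stacked r (A - r) (B - s))"
proof -
  \<comment> \<open>A rooted word without big letters is empty, so \<open>r = 0\<close>, and
    \<open>stacked 0\<close> vanishes when big cars remain.\<close>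
  have "block c 0 * (\<Sum>w\<in>rooted_words r 0. q ^ word_inv w) * stacked r (A - r) (Suc B - 0) = 0" for r
    by (simp add: rooted_words_0 stacked_0_Suc)
  then show ?thesis
    unfolding stacked_recurrence sum.atMost_Suc_shift sum_rooted_word_inv
    by (simp only: add_0_left diff_Suc_Suc)
qed

text \<open>
  Putting an extra big car at level 0 in front makes every list anchored; a level with a single
  small car below it then turns the whole sum into one value of \<^const>\<open>stacked\<close>.
\<close>

lemma sum_coloured_lists:
  "q ^ (a * b) * qi (Suc a) *
    (\<Sum>xs\<in>coloured_lists a b. q ^ coloured_dinv xs * inverse q ^ sum_list (map fst xs)) =
    gauss a (Suc b) * gauss a b"
proof -
  let ?S = "\<Sum>xs\<in>coloured_lists a b. q ^ coloured_dinv xs * inverse q ^ sum_list (map fst xs)"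
  \<comment> \<open>\<open>block (Suc 0)\<close> is constantly 1, and the extra column adds nothing
    to dinv or to the levels.\<close>
  have S: "?S = q ^ (a + Suc b) * stacked (Suc 0) a (Suc b)"
    unfolding stacked_eq anchored_lists_Suc block_Suc
    by (simp add: sum.reindex inj_on_def coloured_dinv_snoc_0_True)
  have pow: "q ^ (Suc a * Suc b) = q ^ (a * b) * q ^ (a + Suc b)"
    by (simp add: add_ac flip: power_add)
  have "q ^ (a * b) * qi (Suc a) * ?S = q ^ (Suc a * Suc b) * qi (Suc (a + 0)) * stacked (Suc 0) a (Suc b)"
    unfolding S pow add_0_right by (simp only: mult.assoc mult.commute mult.left_commute)
  also have "\<dots> = qi (Suc 0) * gauss (a + 0) (Suc b) * gauss a b"
    by (rule recurrence_solution) (simp_all only: stacked_0 stacked_recurrence_Suc block_0_right)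
  finally show ?thesis
    by (simp add: q_int_def)
qed

lemma sum_coloured_lists_eq:
  "(\<Sum>xs\<in>coloured_lists a b. q ^ (((a + b) choose 2) + coloured_dinv xs) * inverse q ^ sum_list (map fst xs)) =
    q ^ ((a choose 2) + (b choose 2)) / qi (a + b + 1) *
      q_binomial q (a + b + 1) a * q_binomial q (a + b + 1) b"
proof -
  let ?S = "\<Sum>xs\<in>coloured_lists a b. q ^ coloured_dinv xs * inverse q ^ sum_list (map fst xs)"
  have *: "q_binomial q (a + b + 1) a = gauss a (Suc b)" "q_binomial q (a + b + 1) b = gauss (Suc a) b"
    unfolding gauss_commute[of a "Suc b"] by (simp_all add: gauss_def add.commute)
  have "qi (Suc a) * (qi (Suc (a + b)) * (q ^ (a * b) * ?S)) =
    qi (Suc (a + b)) * (gauss a (Suc b) * gauss a b)"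
    unfolding sum_coloured_lists[symmetric] by (simp only: mult.assoc mult.commute mult.left_commute)
  also have "\<dots> = qi (Suc a) * (gauss a (Suc b) * gauss (Suc a) b)"
    using gauss_Suc_left[of a b] by (simp add: mult_ac)
  finally have "qi (Suc (a + b)) * (q ^ (a * b) * ?S) = gauss a (Suc b) * gauss (Suc a) b"
    using q_int_Suc_nonzero[of a] by simp
  then have "q ^ (a * b) * ?S = gauss a (Suc b) * gauss (Suc a) b / qi (Suc (a + b))"
    using q_int_Suc_nonzero[of "a + b"] by (simp add: field_simps)
  \<comment> \<open>The surplus \<open>a * b\<close> is exactly the power of \<open>q\<close> left
    over in \<open>sum_coloured_lists\<close>.\<close>
  moreover have choose: "(a + b) choose 2 = (a choose 2) + (b choose 2) + a * b"
    by (induction a) (simp_all add: numeral_2_eq_2)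
  have "(\<Sum>xs\<in>coloured_lists a b. q ^ (((a + b) choose 2) + coloured_dinv xs) *
      inverse q ^ sum_list (map fst xs)) = q ^ ((a + b) choose 2) * ?S"
    by (simp add: power_add sum_distrib_left mult_ac)
  moreover have "\<dots> = q ^ ((a choose 2) + (b choose 2)) * (q ^ (a * b) * ?S)"
    by (simp only: choose power_add mult.assoc)
  ultimately show ?thesis
    unfolding * by simp
qed

end

section \<open>Parking functions as coloured area sequences\<close>

lemma admissible_rev_iff:
  "admissible (rev xs) \<longleftrightarrow> (xs \<noteq> [] \<longrightarrow> fst (xs ! 0) = 0) \<and>
     (\<forall>i. 0 < i \<and> i < length xs \<longrightarrow> fst (xs ! i) \<le> fst (xs ! (i - 1)) + 1 \<and>
       (fst (xs ! i) = fst (xs ! (i - 1)) + 1 \<longrightarrow> snd (xs ! i) \<and> \<not> snd (xs ! (i - 1))))"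
proof (induction xs rule: rev_induct)
  case (snoc x xs)
  show ?case
  proof (cases "xs = []")
    case False
    let ?P = "\<lambda>ys i. fst (ys ! i) \<le> fst (ys ! (i - 1)) + 1 \<and>
       (fst (ys ! i) = fst (ys ! (i - 1)) + 1 \<longrightarrow> snd (ys ! i) \<and> \<not> snd (ys ! (i - 1)))"
    have "?P (xs @ [x]) i \<longleftrightarrow> ?P xs i" if "i < length xs" for i
    proof -
      have "i - 1 < length xs" using that by linarith
      with that show ?thesis by (simp only: nth_append if_True)
    qed
    moreover have "?P (xs @ [x]) (length xs) \<longleftrightarrow>
      fst x \<le> fst (last xs) + 1 \<and> (fst x = fst (last xs) + 1 \<longrightarrow> snd x \<and> \<not> snd (last xs))"
      using False by (simp add: nth_append last_conv_nth)
    ultimately have "(\<forall>i. 0 < i \<and> i < length (xs @ [x]) \<longrightarrow> ?P (xs @ [x]) i) \<longleftrightarrow>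
      (\<forall>i. 0 < i \<and> i < length xs \<longrightarrow> ?P xs i) \<and>
      fst x \<le> fst (last xs) + 1 \<and> (fst x = fst (last xs) + 1 \<longrightarrow> snd x \<and> \<not> snd (last xs))"
      using False by (auto simp only: length_append_singleton less_Suc_eq length_greater_0_conv)
    then show ?thesis
      using False snoc.IH by (simp only: rev_append rev.simps append.simps admissible_Cons)
        (auto simp: hd_rev nth_append)
  qed (auto simp: less_Suc_eq)
qed simp

lemma card_pairs_snoc:
  "card {(i, j). i < j \<and> j < length (xs @ [x]) \<and> P ((xs @ [x]) ! i) ((xs @ [x]) ! j)} =
   card {(i, j). i < j \<and> j < length xs \<and> P (xs ! i) (xs ! j)} + length (filter (\<lambda>y. P y x) xs)"
proof -
  let ?A = "{(i, j). i < j \<and> j < length xs \<and> P (xs ! i) (xs ! j)}"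
  let ?B = "(\<lambda>i. (i, length xs)) ` {i. i < length xs \<and> P (xs ! i) x}"
  have "{(i, j). i < j \<and> j < length (xs @ [x]) \<and> P ((xs @ [x]) ! i) ((xs @ [x]) ! j)} = ?A \<union> ?B"
    by (auto simp: nth_append less_Suc_eq)
  moreover have "finite ?A"
    by (rule finite_subset[of _ "{..<length xs} \<times> {..<length xs}"]) auto
  moreover have "card ?B = length (filter (\<lambda>y. P y x) xs)"
    by (simp add: card_image inj_on_def length_filter_conv_card)
  moreover have "?A \<inter> ?B = {}"
    by auto
  ultimately show ?thesis
    by (simp add: card_Un_disjoint)
qed

lemma coloured_dinv_rev:
  "coloured_dinv (rev xs) =
     card {(i, j). i < j \<and> j < length xs \<and>
       fst (xs ! i) = fst (xs ! j) \<and> \<not> snd (xs ! i) \<and> snd (xs ! j)} +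
     card {(i, j). i < j \<and> j < length xs \<and>
       fst (xs ! i) = fst (xs ! j) + 1 \<and> snd (xs ! i) \<and> \<not> snd (xs ! j)}"
proof (induction xs rule: rev_induct)
  case (snoc x xs)
  have "length (filter (\<lambda>y. fst y = fst x \<and> \<not> snd y \<and> snd x) xs) =
      (if snd x then count_list xs (fst x, False) else 0)"
    "length (filter (\<lambda>y. fst y = fst x + 1 \<and> snd y \<and> \<not> snd x) xs) =
      (if snd x then 0 else count_list xs (Suc (fst x), True))"
    by (induction xs) auto
  then show ?case
    unfolding card_pairs_snoc[where P = "\<lambda>y z. fst y = fst z \<and> \<not> snd y \<and> snd z"]
      card_pairs_snoc[where P = "\<lambda>y z. fst y = fst z + 1 \<and> snd y \<and> \<not> snd z"]
    using snoc.IH by simp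
qed simp

section \<open>Reading order and the shuffle condition\<close>

definition reads_before :: "nat list \<Rightarrow> nat \<Rightarrow> nat \<Rightarrow> bool" where
  "reads_before u i j \<longleftrightarrow> u ! j < u ! i \<or> u ! i = u ! j \<and> j < i"

lemma reads_before_asym: "reads_before u i j \<Longrightarrow> \<not> reads_before u j i"
  by (auto simp: reads_before_def)

lemma reads_before_trans: "reads_before u i j \<Longrightarrow> reads_before u j k \<Longrightarrow> reads_before u i k"
  by (auto simp: reads_before_def)

lemma reads_before_total: "i = j \<or> reads_before u i j \<or> reads_before u j i"
  by (auto simp: reads_before_def)

text \<open>Listing columns instead of cars separates the order, which depends on \<open>u\<close>
  alone, from the cars.\<close>

definition reading_order :: "nat list \<Rightarrow> nat list" where
  "reading_order u = concat (map (\<lambda>k. filter (\<lambda>i. u ! i = k) (rev [0..<length u])) (rev [0..<length u]))"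

lemma concat_map_if: "concat (map (\<lambda>x. if P x then [f x] else []) xs) = map f (filter P xs)"
  by (induction xs) auto

lemma diagonal_word_eq: "diagonal_word (v, u) = map (nth v) (reading_order u)"
  by (simp add: diagonal_word_def reading_order_def concat_map_if map_concat comp_def)

lemma sorted_wrt_reading_order: "sorted_wrt (reads_before u) (reading_order u)"
proof -
  have desc: "sorted_wrt (\<lambda>i j. j < i) (rev [0..<n])" for n :: nat
    by (simp add: sorted_wrt_rev)
  have "sorted_wrt (reads_before u) (concat (map (\<lambda>k. filter (\<lambda>i. u ! i = k) (rev [0..<length u])) ks))"
    if "sorted_wrt (\<lambda>i j. j < i) ks" for ks
    using that
  proof (induction ks)
    case (Cons k ks)
    have "sorted_wrt (reads_before u) (filter (\<lambda>i. u ! i = k) (rev [0..<length u]))"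
      by (rule sorted_wrt_mono_rel[OF _ sorted_wrt_filter[OF desc]]) (auto simp: reads_before_def)
    with Cons show ?case
      by (simp add: sorted_wrt_append) (auto simp: reads_before_def)
  qed simp
  with desc show ?thesis
    by (simp add: reading_order_def)
qed

lemma set_reading_order:
  assumes "\<And>i. i < length u \<Longrightarrow> u ! i < length u"
  shows "set (reading_order u) = {..<length u}"
  using assms by (auto simp: reading_order_def)

text \<open>By asymmetry, \<open>R x y\<close> forces \<open>x\<close> to stand before
  \<open>y\<close> in the list. This turns conditions on words into conditions on pairs of
  columns.\<close>

lemma sorted_wrt_iff_of_order:
  assumes "sorted_wrt R xs" "\<And>x y. R x y \<Longrightarrow> \<not> R y x"
  shows "sorted_wrt Q xs \<longleftrightarrow> (\<forall>x\<in>set xs. \<forall>y\<in>set xs. R x y \<longrightarrow> Q x y)"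
proof
  assume Q: "sorted_wrt Q xs"
  show "\<forall>x\<in>set xs. \<forall>y\<in>set xs. R x y \<longrightarrow> Q x y"
  proof (intro ballI impI)
    fix x y assume "x \<in> set xs" "y \<in> set xs" and R: "R x y"
    then obtain i j where ij: "i < length xs" "j < length xs" "x = xs ! i" "y = xs ! j"
      by (auto simp: in_set_conv_nth)
    have "\<not> j < i" "i \<noteq> j"
      using assms R ij by (auto simp: sorted_wrt_iff_nth_less)
    then show "Q x y"
      using Q ij by (auto simp: sorted_wrt_iff_nth_less)
  qed
next
  assume "\<forall>x\<in>set xs. \<forall>y\<in>set xs. R x y \<longrightarrow> Q x y"
  then show "sorted_wrt Q xs"
    using sorted_wrt_mono_rel[OF _ assms(1)] by blast
qed

text \<open>Filtering by colour recovers the two shuffled words; conversely a strictly increasing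
  list is determined by its set.\<close>

lemma in_shuffles_intervals_iff:
  fixes w :: "nat list"
  assumes "set w = {1..a + b}"
  shows "w \<in> shuffles [1..<a + 1] [a + 1..<a + b + 1] \<longleftrightarrow>
    sorted_wrt (<) (filter (\<lambda>x. \<not> a < x) w) \<and> sorted_wrt (<) (filter (\<lambda>x. a < x) w)"
proof
  assume w: "w \<in> shuffles [1..<a + 1] [a + 1..<a + b + 1]"
  have "filter P w \<in> shuffles (filter P [1..<a + 1]) (filter P [a + 1..<a + b + 1])" for P
    using w by (metis filter_shuffles imageI)
  from this[of "\<lambda>x. \<not> a < x"] this[of "\<lambda>x. a < x"]
  have "filter (\<lambda>x. \<not> a < x) w = [1..<a + 1]" "filter (\<lambda>x. a < x) w = [a + 1..<a + b + 1]"
    by (simp_all add: filter_id_conv filter_empty_conv not_less del: upt_Suc cong: filter_cong)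
  then show "sorted_wrt (<) (filter (\<lambda>x. \<not> a < x) w) \<and> sorted_wrt (<) (filter (\<lambda>x. a < x) w)"
    by (simp only: sorted_wrt_upt)
next
  assume "sorted_wrt (<) (filter (\<lambda>x. \<not> a < x) w) \<and> sorted_wrt (<) (filter (\<lambda>x. a < x) w)"
  then have "filter (\<lambda>x. \<not> a < x) w = [1..<a + 1]" "filter (\<lambda>x. a < x) w = [a + 1..<a + b + 1]"
    using assms by (auto intro!: strict_sorted_equal simp del: upt_Suc)
  then show "w \<in> shuffles [1..<a + 1] [a + 1..<a + b + 1]"
    using partition_in_shuffles[of w "\<lambda>x. \<not> a < x"] by (simp only: not_not)
qed

lemma shuffle_parking_functions_iff:
  "(v, u) \<in> shuffle_parking_functions a b \<longleftrightarrow> (v, u) \<in> parking_functions (a + b) \<and>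
    (\<forall>i<a + b. \<forall>j<a + b. reads_before u i j \<longrightarrow> (a < v ! i) = (a < v ! j) \<longrightarrow> v ! i < v ! j)"
proof (cases "(v, u) \<in> parking_functions (a + b)")
  case True
  let ?\<rho> = "reading_order u"
  have len: "length v = a + b" "length u = a + b" and v: "set v = {1..a + b}"
    using True by (auto simp: parking_functions_def)
  have \<rho>: "set ?\<rho> = {..<a + b}"
    using nth_le_index[OF True] len by (subst set_reading_order) (auto intro: le_less_trans)
  have filter_sorted: "sorted_wrt Q (filter P ?\<rho>) \<longleftrightarrow>
      (\<forall>i\<in>set (filter P ?\<rho>). \<forall>j\<in>set (filter P ?\<rho>). reads_before u i j \<longrightarrow> Q i j)" for P Q
    by (rule sorted_wrt_iff_of_order[OF sorted_wrt_filter[OF sorted_wrt_reading_order]])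
       (rule reads_before_asym)
  have "nth v ` {..<a + b} = set v"
    using len by (auto simp: in_set_conv_nth)
  then have "set (diagonal_word (v, u)) = {1..a + b}"
    by (simp add: diagonal_word_eq \<rho> v)
  then have "diagonal_word (v, u) \<in> shuffles [1..<a + 1] [a + 1..<a + b + 1] \<longleftrightarrow>
    sorted_wrt (\<lambda>i j. v ! i < v ! j) (filter (\<lambda>i. \<not> a < v ! i) ?\<rho>) \<and>
    sorted_wrt (\<lambda>i j. v ! i < v ! j) (filter (\<lambda>i. a < v ! i) ?\<rho>)"
    by (simp only: in_shuffles_intervals_iff) (simp add: diagonal_word_eq filter_map sorted_wrt_map comp_def)
  also have "\<dots> \<longleftrightarrow> (\<forall>i<a + b. \<forall>j<a + b. reads_before u i j \<longrightarrow> (a < v ! i) = (a < v ! j) \<longrightarrow> v ! i < v ! j)"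
    unfolding filter_sorted set_filter \<rho> by blast
  finally show ?thesis
    using True by (simp add: shuffle_parking_functions_def)
qed (simp add: shuffle_parking_functions_def)

section \<open>Recovering the cars from levels and colours\<close>

definition class_rank :: "nat list \<Rightarrow> bool list \<Rightarrow> nat \<Rightarrow> nat" where
  "class_rank u c i = card {j. j < length u \<and> c ! j = c ! i \<and> (j = i \<or> reads_before u j i)}"

text \<open>The cars of one colour fill an interval and increase along the reading order, so a car
  is its rank in its colour class plus the offset of that interval.\<close>

lemma car_eq_class_rank:
  assumes PF: "(v, u) \<in> shuffle_parking_functions a b" and i: "i < a + b"
  shows "v ! i = (if a < v ! i then a else 0) + class_rank u (map (\<lambda>x. a < x) v) i"
proof -
  have len: "length v = a + b" "length u = a + b" and v: "distinct v" "set v = {1..a + b}"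
    and ord: "\<And>i j. i < a + b \<Longrightarrow> j < a + b \<Longrightarrow> reads_before u i j \<Longrightarrow>
      (a < v ! i) = (a < v ! j) \<Longrightarrow> v ! i < v ! j"
    using PF by (auto simp: shuffle_parking_functions_iff parking_functions_def)
  let ?J = "{j. j < a + b \<and> (a < v ! j) = (a < v ! i) \<and> (j = i \<or> reads_before u j i)}"
  have le_iff: "v ! j \<le> v ! i \<longleftrightarrow> j = i \<or> reads_before u j i"
    if "j < a + b" "(a < v ! j) = (a < v ! i)" for j
    using that i ord[of i j] ord[of j i] reads_before_total[of i j u] by fastforce
  have "nth v ` ?J = {x \<in> set v. (a < x) = (a < v ! i) \<and> x \<le> v ! i}"
    using le_iff len by (auto simp: in_set_conv_nth)
  also have "\<dots> = (if a < v ! i then {a<..v ! i} else {0<..v ! i})"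
    using i len v(2) nth_mem[of i v] by auto
  finally have "card (nth v ` ?J) = v ! i - (if a < v ! i then a else 0)"
    by simp
  moreover have "inj_on (nth v) ?J"
    using v(1) len by (auto simp: inj_on_def nth_eq_iff_index_eq)
  ultimately have "card ?J = v ! i - (if a < v ! i then a else 0)"
    by (simp add: card_image)
  moreover have "class_rank u (map (\<lambda>x. a < x) v) i = card ?J"
    unfolding class_rank_def using i len by (intro arg_cong[where f = card]) auto
  ultimately show ?thesis by auto
qed

definition encode :: "nat \<Rightarrow> two_line \<Rightarrow> coloured" where
  "encode a = (\<lambda>(v, u). rev (zip u (map (\<lambda>x. a < x) v)))"

lemma inj_on_encode: "inj_on (encode a) (shuffle_parking_functions a b)"
proof (rule inj_onI, clarify)
  fix v u v' u'
  assume PF: "(v, u) \<in> shuffle_parking_functions a b" and PF': "(v', u') \<in> shuffle_parking_functions a b"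
    and "encode a (v, u) = encode a (v', u')"
  moreover have len: "length v = a + b" "length u = a + b" "length v' = a + b" "length u' = a + b"
    using PF PF' by (auto simp: shuffle_parking_functions_iff parking_functions_def)
  ultimately have u: "u = u'" and c: "map (\<lambda>x. a < x) v = map (\<lambda>x. a < x) v'"
    by (auto simp: encode_def zip_eq_conv)
  have "v ! i = v' ! i" if "i < a + b" for i
  proof -
    have "(a < v ! i) = (a < v' ! i)"
      using that len arg_cong[OF c, of "\<lambda>c. c ! i"] by simp
    then show ?thesis
      using car_eq_class_rank[OF PF that] car_eq_class_rank[OF PF' that] u c by presburger
  qed
  then show "v = v' \<and> u = u'"
    using u len by (auto intro: nth_equalityI)
qed

lemma count_colours:
  assumes "distinct v" "set v = {1..a + b}"
  shows "count_list (map (\<lambda>x. a < x) v) False = a" "count_list (map (\<lambda>x. a < x) v) True = b"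
proof -
  have *: "count_list (map f v) c = card {x \<in> set v. f x = c}" for f :: "nat \<Rightarrow> bool" and c
  proof -
    have "count_list (map f v) c = length (filter (\<lambda>x. f x = c) v)"
      by (induction v) auto
    then show ?thesis
      using distinct_card[of "filter (\<lambda>x. f x = c) v"] assms(1) by simp
  qed
  have "{x \<in> {1..a + b}. (a < x) = False} = {1..a}" "{x \<in> {1..a + b}. (a < x) = True} = {a<..a + b}"
    by auto
  then show "count_list (map (\<lambda>x. a < x) v) False = a" "count_list (map (\<lambda>x. a < x) v) True = b"
    unfolding * assms(2) by simp_all
qed

text \<open>A raised column is read before its left neighbour, so equal colours would give it the
  smaller car; an increase at a rise therefore means small followed by big.\<close>

lemma parking_condition_iff:
  assumes "length v = n" "length u = n" "distinct v" "set v = {1..n}"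
    and "\<And>i j. i < n \<Longrightarrow> j < n \<Longrightarrow> reads_before u i j \<Longrightarrow> (a < v ! i) = (a < v ! j) \<Longrightarrow> v ! i < v ! j"
  shows "(v, u) \<in> parking_functions n \<longleftrightarrow> admissible (encode a (v, u))"
proof -
  have "v ! (i - 1) < v ! i \<longleftrightarrow> a < v ! i \<and> \<not> a < v ! (i - 1)"
    if "0 < i" "i < n" "u ! i = u ! (i - 1) + 1" for i
  proof -
    have "i - 1 < n" "reads_before u i (i - 1)"
      using that by (auto simp: reads_before_def)
    then show ?thesis
      using that assms(5)[of i "i - 1"] by (cases "a < v ! i"; cases "a < v ! (i - 1)") auto
  qed
  then show ?thesis
    using assms(1-4) unfolding encode_def parking_functions_def
    by (auto simp: admissible_rev_iff)
qed

lemma encode_in_coloured_lists: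
  assumes PF: "PF \<in> shuffle_parking_functions a b"
  shows "encode a PF \<in> coloured_lists a b"
proof -
  obtain v u where PF_eq: "PF = (v, u)" by fastforce
  have PF': "(v, u) \<in> parking_functions (a + b)"
    and ord: "\<And>i j. i < a + b \<Longrightarrow> j < a + b \<Longrightarrow> reads_before u i j \<Longrightarrow>
      (a < v ! i) = (a < v ! j) \<Longrightarrow> v ! i < v ! j"
    using PF by (auto simp: PF_eq shuffle_parking_functions_iff)
  then have len: "length v = a + b" "length u = a + b" "distinct v" "set v = {1..a + b}"
    by (auto simp: parking_functions_def)
  have "admissible (encode a (v, u))"
    using parking_condition_iff[OF len ord] PF' by blast
  then show ?thesis
    using count_colours[OF len(3,4)] len
    by (simp add: PF_eq coloured_lists_def encode_def rev_map[symmetric] count_list_rev)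
qed

lemma encode_surj:
  assumes xs: "xs \<in> coloured_lists a b"
  shows "xs \<in> encode a ` shuffle_parking_functions a b"
proof -
  define u c where "u = map fst (rev xs)" and "c = map snd (rev xs)"
  define rank where "rank = class_rank u c"
  \<comment> \<open>By \<open>car_eq_class_rank\<close> these are the only possible cars.\<close>
  define v where "v = map (\<lambda>i. (if c ! i then a else 0) + rank i) [0..<a + b]"
  have len: "length u = a + b" "length c = a + b" "length v = a + b"
    using length_coloured_lists[OF xs] by (simp_all add: u_def c_def v_def)
  have card_class: "card {j. j < a + b \<and> c ! j = d} = (if d then b else a)" for d
  proof -
    have "card {j. j < a + b \<and> c ! j = d} = length (filter (\<lambda>x. x = d) c)"
      by (simp add: length_filter_conv_card len)
    also have "\<dots> = count_list c d"
      by (induction c) auto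
    also have "\<dots> = (if d then b else a)"
      using xs by (cases d) (auto simp: c_def coloured_lists_def rev_map[symmetric] count_list_rev)
    finally show ?thesis .
  qed
  \<comment> \<open>With \<open>rank_pos\<close> this keeps small cars in \<open>1..a\<close> and
    big ones above \<open>a\<close>, so the colours are recovered from \<open>v\<close>.\<close>
  have rank_le: "rank i \<le> (if c ! i then b else a)" for i
    unfolding card_class[symmetric] rank_def class_rank_def len by (intro card_mono) auto
  have rank_pos: "0 < rank i" if "i < a + b" for i
    using that unfolding rank_def class_rank_def len by (subst card_gt_0_iff) auto
  have rank_less: "rank i < rank j" if "i < a + b" "j < a + b" "reads_before u i j" "c ! i = c ! j" for i j
    unfolding rank_def class_rank_def len
  proof (rule psubset_card_mono)
    let ?L = "{k. k < a + b \<and> c ! k = c ! i \<and> (k = i \<or> reads_before u k i)}"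
    let ?R = "{k. k < a + b \<and> c ! k = c ! j \<and> (k = j \<or> reads_before u k j)}"
    have "?L \<subseteq> ?R"
      using that(3,4) by (auto dest: reads_before_trans)
    moreover have "j \<in> ?R" "j \<notin> ?L"
      using that(2,3) by (auto simp: reads_before_def)
    ultimately show "?L \<subset> ?R" by blast
  qed simp
  have v_nth: "v ! i = (if c ! i then a else 0) + rank i" if "i < a + b" for i
    using that by (simp add: v_def)
  have colour: "a < v ! i \<longleftrightarrow> c ! i" if "i < a + b" for i
    using rank_le[of i] rank_pos[OF that] by (auto simp: v_nth[OF that])
  have map_colour: "map (\<lambda>x. a < x) v = c"
    using len colour by (auto intro: nth_equalityI)
  have ord: "v ! i < v ! j" if "i < a + b" "j < a + b" "reads_before u i j" "(a < v ! i) = (a < v ! j)" for i j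
  proof -
    have "c ! i = c ! j"
      using that colour by blast
    with that(1-3) have "rank i < rank j"
      by (rule rank_less)
    then show ?thesis
      using \<open>c ! i = c ! j\<close> by (simp add: v_nth that(1,2))
  qed
  have "distinct v"
    unfolding distinct_conv_nth len
  proof (intro allI impI)
    fix i j assume "i < a + b" "j < a + b" "i \<noteq> j"
    then show "v ! i \<noteq> v ! j"
      using ord[of i j] ord[of j i] reads_before_total[of i j u] by fastforce
  qed
  moreover have "set v \<subseteq> {1..a + b}"
  proof
    fix x assume "x \<in> set v"
    then obtain i where "i < a + b" "x = v ! i"
      using len by (auto simp: in_set_conv_nth)
    then show "x \<in> {1..a + b}"
      using rank_le[of i] rank_pos[of i] by (auto simp: v_nth split: if_splits)
  qed
  \<comment> \<open>\<open>a + b\<close> distinct values inside a set of size \<open>a + b\<close>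
    exhaust it.\<close>
  ultimately have set_v: "distinct v" "set v = {1..a + b}"
    using distinct_card[of v] len card_subset_eq[of "{1..a + b}" "set v"] by simp_all
  have enc: "encode a (v, u) = xs"
    unfolding encode_def by (simp add: map_colour) (simp add: u_def c_def zip_map_fst_snd)
  have "(v, u) \<in> parking_functions (a + b)"
    using parking_condition_iff[OF len(3,1) set_v ord] xs by (simp add: enc coloured_lists_def)
  then have "(v, u) \<in> shuffle_parking_functions a b"
    using ord by (auto simp: shuffle_parking_functions_iff)
  with enc show ?thesis by force
qed

lemma bij_betw_encode: "bij_betw (encode a) (shuffle_parking_functions a b) (coloured_lists a b)"
  unfolding bij_betw_def using inj_on_encode encode_in_coloured_lists encode_surj by blast

lemma coloured_dinv_encode:
  assumes PF: "PF \<in> shuffle_parking_functions a b"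
  shows "coloured_dinv (encode a PF) = dinv PF"
proof -
  obtain v u where PF_eq: "PF = (v, u)" by fastforce
  have len: "length v = a + b" "length u = a + b"
    and ord: "\<And>i j. i < a + b \<Longrightarrow> j < a + b \<Longrightarrow> reads_before u i j \<Longrightarrow>
      (a < v ! i) = (a < v ! j) \<Longrightarrow> v ! i < v ! j"
    using PF by (auto simp: PF_eq shuffle_parking_functions_iff parking_functions_def)
  have same: "v ! i < v ! j \<longleftrightarrow> \<not> a < v ! i \<and> a < v ! j" if "i < j" "j < a + b" "u ! i = u ! j" for i j
    using that ord[of j i] by (cases "a < v ! i"; cases "a < v ! j") (auto simp: reads_before_def)
  have above: "v ! j < v ! i \<longleftrightarrow> a < v ! i \<and> \<not> a < v ! j" if "i < j" "j < a + b" "u ! i = u ! j + 1" for i j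
    using that ord[of i j] by (cases "a < v ! i"; cases "a < v ! j") (auto simp: reads_before_def)
  have "{(i, j). i < j \<and> j < a + b \<and> u ! i = u ! j \<and> v ! i < v ! j} =
    {(i, j). i < j \<and> j < a + b \<and> u ! i = u ! j \<and> \<not> a < v ! i \<and> a < v ! j}"
    "{(i, j). i < j \<and> j < a + b \<and> u ! i = u ! j + 1 \<and> v ! j < v ! i} =
    {(i, j). i < j \<and> j < a + b \<and> u ! i = u ! j + 1 \<and> a < v ! i \<and> \<not> a < v ! j}"
    using same above by blast+
  moreover have "{(i, j). i < j \<and> j < a + b \<and> u ! i = u ! j \<and> \<not> a < v ! i \<and> a < v ! j} =
      {(i, j). i < j \<and> j < length (zip u (map (\<lambda>x. a < x) v)) \<and>
       fst (zip u (map (\<lambda>x. a < x) v) ! i) = fst (zip u (map (\<lambda>x. a < x) v) ! j) \<and>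
       \<not> snd (zip u (map (\<lambda>x. a < x) v) ! i) \<and> snd (zip u (map (\<lambda>x. a < x) v) ! j)}"
    "{(i, j). i < j \<and> j < a + b \<and> u ! i = u ! j + 1 \<and> a < v ! i \<and> \<not> a < v ! j} =
      {(i, j). i < j \<and> j < length (zip u (map (\<lambda>x. a < x) v)) \<and>
       fst (zip u (map (\<lambda>x. a < x) v) ! i) = fst (zip u (map (\<lambda>x. a < x) v) ! j) + 1 \<and>
       snd (zip u (map (\<lambda>x. a < x) v) ! i) \<and> \<not> snd (zip u (map (\<lambda>x. a < x) v) ! j)}"
    using len by auto
  ultimately show ?thesis
    by (simp only: PF_eq encode_def dinv_def prod.case coloured_dinv_rev len)
qed

lemma area_encode:
  assumes "PF \<in> shuffle_parking_functions a b"
  shows "sum_list (map fst (encode a PF)) = area PF"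
proof -
  obtain v u where PF_eq: "PF = (v, u)" by fastforce
  have "length v = length u"
    using assms by (auto simp: PF_eq shuffle_parking_functions_iff parking_functions_def)
  then have "sum_list (map fst (encode a PF)) = sum_list u"
    by (simp add: PF_eq encode_def rev_map[symmetric] sum_list_rev)
  then show ?thesis
    by (simp add: PF_eq area_def sum_list_sum_nth atLeast0LessThan)
qed

section \<open>Specialisation to the indeterminate\<close>

lemma q_int_indet: "q_int indet n = Fract (\<Sum>i<n. [:0, 1:] ^ i) 1"
proof -
  have "indet ^ i = Fract ([:0, 1:] ^ i) 1" for i
    by (induction i) (simp_all add: indet_def One_fract_def)
  then show ?thesis
    unfolding q_int_def by (induction n) (simp_all add: Zero_fract_def)
qed

lemma generic_q_indet: "generic_q indet"
proof
  show "indet \<noteq> 0"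
    by (simp add: indet_def Zero_fract_def eq_fract)
  fix n
  \<comment> \<open>The constant term 1 shows that the polynomial is nonzero.\<close>
  have "poly (\<Sum>i<Suc n. [:0, 1:] ^ i) (0 :: rat) = 1"
    by (simp add: poly_sum sum.lessThan_Suc_shift del: sum.lessThan_Suc)
  then have "(\<Sum>i<Suc n. [:0, 1:] ^ i) \<noteq> (0 :: rat poly)"
    by (metis poly_0 zero_neq_one)
  then show "q_int indet (Suc n) \<noteq> 0"
    by (simp add: q_int_indet Zero_fract_def eq_fract)
qed

theorem theorem1p4:
  fixes a b :: nat
  shows "(\<Sum>PF\<in>shuffle_parking_functions a b. indet ^ (coarea PF + dinv PF)) =
    indet ^ ((a choose 2) + (b choose 2)) / q_int indet (a + b + 1) *
      q_binomial indet (a + b + 1) a * q_binomial indet (a + b + 1) b"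
proof -
  interpret generic_q indet
    by (rule generic_q_indet)
  have "(\<Sum>PF\<in>shuffle_parking_functions a b. indet ^ (coarea PF + dinv PF)) =
    (\<Sum>PF\<in>shuffle_parking_functions a b. indet ^ (((a + b) choose 2) + coloured_dinv (encode a PF)) *
      inverse indet ^ sum_list (map fst (encode a PF)))"
  proof (intro sum.cong refl)
    fix PF assume PF: "PF \<in> shuffle_parking_functions a b"
    then have PF': "PF \<in> parking_functions (a + b)"
      by (simp add: shuffle_parking_functions_def)
    \<comment> \<open>By \<open>area_le\<close> the subtraction in \<open>coarea\<close> is exact,
      so area can be marked by the inverse of the indeterminate.\<close>
    then have "coarea PF + area PF = (a + b) choose 2"
      using area_le[OF PF'] by (auto simp: coarea_def parking_functions_def)
    then have "indet ^ ((a + b) choose 2) = indet ^ coarea PF * indet ^ area PF"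
      by (metis power_add)
    then have "indet ^ coarea PF = indet ^ ((a + b) choose 2) * inverse indet ^ area PF"
      using q_nonzero by (simp add: field_simps)
    then show "indet ^ (coarea PF + dinv PF) = indet ^ (((a + b) choose 2) + coloured_dinv (encode a PF)) *
      inverse indet ^ sum_list (map fst (encode a PF))"
      by (simp add: coloured_dinv_encode[OF PF] area_encode[OF PF] power_add)
  qed
  also have "\<dots> = (\<Sum>xs\<in>coloured_lists a b. indet ^ (((a + b) choose 2) + coloured_dinv xs) *
      inverse indet ^ sum_list (map fst xs))"
    by (rule sum.reindex_bij_betw[OF bij_betw_encode])
  finally show ?thesis
    by (simp only: sum_coloured_lists_eq)
qed

end
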